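(* Let $n\ge2$. There exists a constant $c_\star=c_\star(n)>1$ such that, for all $0<\varepsilon<1$ and all $\mathtt K\ge6\mathtt K_{\rm o}\ge12$, with $\alpha=\sqrt\varepsilon\,\mathtt K^{\nu}$, $\nu=\frac92n+2$, one has $$\mathrm{meas}(\mathcal R^2)\le c_\star\,\alpha^2\,\mathtt K^{2n}.$$
   Context: $|k|_1=\sum|k_j|$, $|\cdot|$ is the Euclidean norm, meas is Lebesgue measure in $\mathbb R^n$. $\mathcal G^n$ is the set of $k\in\mathbb Z^n\setminus\{0\}$ whose first non-null component is positive and with $\gcd(k_1,\dots,k_n)=1$; $\mathcal G^n_K=\{k\in\mathcal G^n:|k|_1\le K\}$. $\mathrm B=\{y\in\mathbb R^n:|y|<1\}$; $\mathtt p_ky=(y\cdot k)k/|k|^2$, $\mathtt p_k^\perp y=y-\mathtt p_ky$. $$\mathcal R^0=\{y\in\mathrm B:\min_{k\in\mathcal G^n_{\mathtt K_{\rm o}}}|y\cdot k|>\tfrac\alpha2\},\qquad \mathcal R^{1,k}=\{y\in\mathrm B:|y\cdot k|<\alpha,\ |\mathtt p_k^\perp y\cdot\ell|>\tfrac{3\alpha\mathtt K}{|k|}\ \forall\ell\in\mathcal G^n_{\mathtt K}\setminus\mathbb Zk\},$$ $$\mathcal R^1=\bigcup_{k\in\mathcal G^n_{\mathtt K_{\rm o}}}\mathcal R^{1,k},\qquad \mathcal R^2=\mathrm B\setminus(\mathcal R^0\cup\mathcal R^1).$$ *)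

theory Defs
  imports "HOL-Analysis.Analysis"
begin

definition norm1 :: "int ^ 'n \<Rightarrow> int" where
  "norm1 k = (\<Sum>i\<in>UNIV. \<bar>k $ i\<bar>)"

definition vec_of_int :: "int ^ 'n \<Rightarrow> real ^ 'n" where
  "vec_of_int k = (\<chi> i. real_of_int (k $ i))"

text \<open>The linear order on the index type serves only to make sense of
  ``the first non-null component''.\<close>

definition \<G> :: "(int ^ 'n::{finite,linorder}) set" where
  "\<G> = {k. k \<noteq> 0 \<and> (\<exists>i. 0 < k $ i \<and> (\<forall>j<i. k $ j = 0)) \<and> (GCD i. k $ i) = 1}"

definition \<G>_upto :: "real \<Rightarrow> (int ^ 'n::{finite,linorder}) set" where
  "\<G>_upto K = {k \<in> \<G>. real_of_int (norm1 k) \<le> K}"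

definition int_multiples :: "int ^ 'n \<Rightarrow> (int ^ 'n) set" where
  "int_multiples k = {m *s k | m. True}"

definition B :: "(real ^ 'n) set" where
  "B = {y. norm y < 1}"

definition proj :: "int ^ 'n \<Rightarrow> real ^ 'n \<Rightarrow> real ^ 'n" where
  "proj k y = ((y \<bullet> vec_of_int k) / (norm (vec_of_int k))\<^sup>2) *\<^sub>R vec_of_int k"

definition proj_perp :: "int ^ 'n \<Rightarrow> real ^ 'n \<Rightarrow> real ^ 'n" where
  "proj_perp k y = y - proj k y"

text \<open>The minimum below is over a finite set, which is nonempty as soon as \<open>Ko \<ge> 1\<close>.\<close>

definition R0 :: "real \<Rightarrow> real \<Rightarrow> (real ^ 'n::{finite,linorder}) set" where
  "R0 \<alpha> Ko = {y \<in> B. Min ((\<lambda>k. \<bar>y \<bullet> vec_of_int k\<bar>) ` \<G>_upto Ko) > \<alpha> / 2}"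

definition R1k :: "real \<Rightarrow> real \<Rightarrow> int ^ 'n::{finite,linorder} \<Rightarrow> (real ^ 'n::{finite,linorder}) set" where
  "R1k \<alpha> K k = {y \<in> B. \<bar>y \<bullet> vec_of_int k\<bar> < \<alpha> \<and>
     (\<forall>l \<in> \<G>_upto K - int_multiples k.
        \<bar>proj_perp k y \<bullet> vec_of_int l\<bar> > 3 * \<alpha> * K / norm (vec_of_int k))}"

definition R1 :: "real \<Rightarrow> real \<Rightarrow> real \<Rightarrow> (real ^ 'n::{finite,linorder}) set" where
  "R1 \<alpha> Ko K = (\<Union>k \<in> \<G>_upto Ko. R1k \<alpha> K k)"

definition R2 :: "real \<Rightarrow> real \<Rightarrow> real \<Rightarrow> (real ^ 'n::{finite,linorder}) set" where
  "R2 \<alpha> Ko K = B - (R0 \<alpha> Ko \<union> R1 \<alpha> Ko K)"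

lemma finite_\<G>_upto: "finite (\<G>_upto K :: (int ^ 'n::{finite,linorder}) set)"
proof -
  have "\<G>_upto K \<subseteq> vec_lambda ` (PiE (UNIV :: 'n set) (\<lambda>_. {-\<lfloor>K\<rfloor>..\<lfloor>K\<rfloor>}))"
  proof
    fix k :: "int ^ 'n::{finite,linorder}" assume "k \<in> \<G>_upto K"
    then have *: "norm1 k \<le> \<lfloor>K\<rfloor>" by (simp add: \<G>_upto_def le_floor_iff)
    have "\<bar>k $ i\<bar> \<le> \<lfloor>K\<rfloor>" for i
      using member_le_sum[of i UNIV "\<lambda>i. \<bar>k $ i\<bar>"] * unfolding norm1_def by simp
    then have "vec_nth k \<in> PiE UNIV (\<lambda>_. {-\<lfloor>K\<rfloor>..\<lfloor>K\<rfloor>})"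
      by (auto simp: abs_le_iff minus_le_iff)
    then show "k \<in> vec_lambda ` (PiE UNIV (\<lambda>_. {-\<lfloor>K\<rfloor>..\<lfloor>K\<rfloor>}))"
      by (intro image_eqI[of _ _ "vec_nth k"]) simp_all
  qed
  then show ?thesis by (rule finite_subset) (intro finite_imageI finite_PiE; simp)
qed

lemma \<G>_upto_nonempty:
  assumes "Ko \<ge> 1"
  shows "\<G>_upto Ko \<noteq> ({} :: (int ^ 'n::{finite,linorder}) set)"
proof -
  define i where "i = Min (UNIV :: 'n set)"
  define k :: "int ^ 'n::{finite,linorder}" where "k = axis i 1"
  have k: "k $ j = (if j = i then 1 else 0)" for j by (auto simp: k_def axis_def)
  have "(GCD j. k $ j) dvd k $ i" by (rule Gcd_dvd) simp
  then have "(GCD j. k $ j) = 1" by (simp add: k)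
  moreover have "\<forall>j<i. k $ j = 0" by (simp add: k)
  moreover have "k \<noteq> 0" using k[of i] by auto
  moreover have "0 < k $ i" by (simp add: k)
  moreover have "norm1 k = 1" by (simp add: norm1_def k if_distrib[of abs] cong: if_cong)
  ultimately have "k \<in> \<G>_upto Ko" using assms unfolding \<G>_upto_def \<G>_def by auto
  then show ?thesis by blast
qed

lemma R2_lmeasurable:
  assumes "Ko \<ge> 1"
  shows "(R2 \<alpha> Ko K :: (real ^ 'n::{finite,linorder}) set) \<in> lmeasurable"
proof -
  have B: "B = (ball 0 1 :: (real ^ 'n::{finite,linorder}) set)" by (auto simp: B_def)
  have "R0 \<alpha> Ko = B \<inter> (\<Inter>k\<in>\<G>_upto Ko. {y :: real ^ 'n::{finite,linorder}. \<alpha> / 2 < \<bar>y \<bullet> vec_of_int k\<bar>})"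
    unfolding R0_def
    by (subst Min_gr_iff) (auto simp: finite_\<G>_upto \<G>_upto_nonempty[OF assms])
  moreover have "open {y :: real ^ 'n::{finite,linorder}. \<alpha> / 2 < \<bar>y \<bullet> vec_of_int k\<bar>}" for k
    by (intro open_Collect_less continuous_intros)
  ultimately have R0: "open (R0 \<alpha> Ko :: (real ^ 'n::{finite,linorder}) set)"
    by (auto simp: B intro!: open_Int open_INT finite_\<G>_upto)
  have "R1k \<alpha> K k = B \<inter> {y :: real ^ 'n::{finite,linorder}. \<bar>y \<bullet> vec_of_int k\<bar> < \<alpha>} \<inter>
      (\<Inter>l\<in>\<G>_upto K - int_multiples k.
        {y. 3 * \<alpha> * K / norm (vec_of_int k) < \<bar>proj_perp k y \<bullet> vec_of_int l\<bar>})" for k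
    unfolding R1k_def by auto
  moreover have "open {y :: real ^ 'n::{finite,linorder}. \<bar>y \<bullet> vec_of_int k\<bar> < \<alpha>}" for k
    by (intro open_Collect_less continuous_intros)
  moreover have "open {y :: real ^ 'n::{finite,linorder}. 3 * \<alpha> * K / norm (vec_of_int k)
      < \<bar>proj_perp k y \<bullet> vec_of_int l\<bar>}" for k l
    unfolding proj_perp_def proj_def divide_inverse
    by (intro open_Collect_less continuous_intros)
  ultimately have "open (R1k \<alpha> K k :: (real ^ 'n::{finite,linorder}) set)" for k
    by (auto simp: B intro!: open_Int open_INT finite_Diff finite_\<G>_upto)
  then have R1: "open (R1 \<alpha> Ko K :: (real ^ 'n::{finite,linorder}) set)" unfolding R1_def by blast
  show ?thesis
    unfolding R2_def B
    by (intro lmeasurable_open fmeasurable.Diff fmeasurable_Diff lmeasurable_ball)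
       (use R0 R1 in \<open>auto intro!: borel_open\<close>)
qed

end

theory Submission
  imports Defs
begin

text \<open>
  A point of the unit ball that lies neither in \<open>R0\<close> nor in \<open>R1\<close> is close to two resonances at
  once: some \<open>k \<in> \<G>_upto Ko\<close> has \<open>\<bar>y \<bullet> k\<bar> \<le> \<alpha> / 2\<close>, and since \<open>y\<close> is then not in \<open>R1k \<alpha> K k\<close>, some
  \<open>l \<in> \<G>_upto K\<close> that is not a multiple of \<open>k\<close> has \<open>\<bar>proj_perp k y \<bullet> l\<bar> \<le> 3 * \<alpha> * K / \<bar>k\<bar>\<close>
  (here and below \<open>\<bar>k\<bar>\<close> is the Euclidean norm). So \<open>R2\<close> is covered by the sets
  \<open>double_resonance \<alpha> K k l\<close>, and it remains to bound the volume of each and to sum.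

  \<^emph>\<open>Volume.\<close> The two linear forms \<open>y \<mapsto> y \<bullet> k\<close> and \<open>y \<mapsto> proj_perp k y \<bullet> l\<close> are bounded by \<open>\<alpha>\<close> and
  \<open>3 * \<alpha> * K / \<bar>k\<bar>\<close>. Because \<open>k\<close> is primitive and \<open>l\<close> is not a multiple of it, some \<open>2 \<times> 2\<close> minor of
  \<open>(k, l)\<close> in columns \<open>i\<close>, \<open>j\<close> is nonzero (\<open>\<G>_minor_nonzero\<close>). Replace the coordinates \<open>i\<close> and \<open>j\<close> by
  the two forms. The second form differs from \<open>y \<mapsto> y \<bullet> l\<close> by a multiple of the first, so this linear
  map has the determinant of an invertible integer matrix, of absolute value at least 1. Hence the
  volume is at most that of the image, which lies in a box of volume
  \<open>2 ^ n * \<alpha> * (3 * \<alpha> * K / \<bar>k\<bar>)\<close> (\<open>measure_slab_le\<close>).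

  \<^emph>\<open>Summation.\<close> There are at most \<open>(3 * K) ^ n\<close> vectors \<open>l\<close>. Counting the \<open>k\<close> alone would cost a
  factor \<open>Ko ^ n\<close> and give a total of order \<open>\<alpha>\<^sup>2 * K ^ (2 * n + 1)\<close>. The factor \<open>1 / \<bar>k\<bar>\<close> gains the
  missing power: the sum of \<open>1 / \<bar>k\<bar>\<close> over \<open>\<G>_upto Ko\<close> is of order \<open>Ko ^ (n - 1)\<close>
  (\<open>sum_inverse_norm_\<G>_upto_le\<close>), as comparison with the integral of \<open>1 / \<bar>x\<bar>\<close> over a ball in dimension
  \<open>n \<ge> 2\<close> suggests. The total is \<open>\<alpha>\<^sup>2 * K ^ (2 * n)\<close> times a constant that depends only on \<open>n\<close>.
\<close>

section \<open>Counting integer vectors\<close>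

lemma
  fixes F :: "'n::finite \<Rightarrow> int set"
  assumes "\<And>i. finite (F i)"
  shows finite_int_vec_product: "finite {k :: int ^ 'n. \<forall>i. k $ i \<in> F i}"
    and card_int_vec_product: "card {k :: int ^ 'n. \<forall>i. k $ i \<in> F i} = (\<Prod>i\<in>UNIV. card (F i))"
proof -
  have bij: "bij_betw vec_lambda (PiE UNIV F) {k :: int ^ 'n. \<forall>i. k $ i \<in> F i}"
    by (rule bij_betw_byWitness[where f' = vec_nth]) auto
  have "finite (PiE UNIV F)"
    using assms by (intro finite_PiE) auto
  with bij show "finite {k :: int ^ 'n. \<forall>i. k $ i \<in> F i}"
    using bij_betw_finite by blast
  from bij show "card {k :: int ^ 'n. \<forall>i. k $ i \<in> F i} = (\<Prod>i\<in>UNIV. card (F i))"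
    by (simp add: bij_betw_same_card[symmetric] card_PiE)
qed

lemma abs_component_le_norm1: "\<bar>k $ i\<bar> \<le> norm1 k"
  unfolding norm1_def by (rule member_le_sum) auto

lemma card_\<G>_upto_le:
  assumes "K \<ge> 1"
  shows "real (card (\<G>_upto K :: (int ^ 'n::{finite,linorder}) set)) \<le> (3 * K) ^ CARD('n)"
proof -
  define N where "N = \<lfloor>K\<rfloor>"
  have N: "N \<ge> 1" "real_of_int N \<le> K"
    using assms by (auto simp: N_def le_floor_iff)
  let ?box = "{k :: (int,'n) vec. \<forall>i. k $ i \<in> {-N..N}}"
  have "\<G>_upto K \<subseteq> ?box"
  proof (clarsimp)
    fix k :: "(int,'n) vec" and i
    assume "k \<in> \<G>_upto K"
    then have "norm1 k \<le> N"
      by (simp add: \<G>_upto_def N_def le_floor_iff)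
    with abs_component_le_norm1[of k i] show "- N \<le> k $ i \<and> k $ i \<le> N"
      by linarith
  qed
  then have "card (\<G>_upto K :: ((int,'n) vec) set) \<le> card ?box"
    by (intro card_mono finite_int_vec_product) auto
  also have "\<dots> = nat (2 * N + 1) ^ CARD('n)"
    by (subst card_int_vec_product) auto
  finally have "real (card (\<G>_upto K :: ((int,'n) vec) set)) \<le> real (nat (2 * N + 1)) ^ CARD('n)"
    by (metis of_nat_le_iff of_nat_power)
  also have "\<dots> \<le> (3 * K) ^ CARD('n)"
    using N assms by (intro power_mono) auto
  finally show ?thesis .
qed

text \<open>
  Sort the vectors by their largest absolute component \<open>m\<close> and a position \<open>i\<close> where it is attained.
  Then \<open>1 / \<bar>k\<bar> \<le> 1 / m\<close>, and for given \<open>i\<close> and \<open>m\<close> there are at most \<open>2 * (2 * m + 1) ^ (n - 1)\<close>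
  vectors: component \<open>i\<close> has two possible values, and each other one at most \<open>2 * m + 1\<close>. A class
  \<open>(i, m)\<close> therefore contributes at most a constant times \<open>m ^ (n - 2)\<close>; summing over \<open>m \<le> K\<close> gives
  \<open>K ^ (n - 1)\<close>.\<close>

lemma sum_inverse_norm_\<G>_upto_le:
  fixes K :: real
  assumes K: "K \<ge> 1" and n: "CARD('n::{finite,linorder}) \<ge> 2"
  shows "(\<Sum>k\<in>(\<G>_upto K :: (int ^ 'n::{finite,linorder}) set). 1 / norm (vec_of_int k))
           \<le> 2 * real CARD('n) * (3 * K) ^ (CARD('n) - 1)"
proof -
  define N where "N = nat \<lfloor>K\<rfloor>"
  have N: "N \<ge> 1" "real N \<le> K"
    using assms by (auto simp: N_def le_floor_iff le_nat_iff)
  define F :: "'n \<Rightarrow> nat \<Rightarrow> 'n \<Rightarrow> int set"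
    where "F = (\<lambda>i m j. if j = i then {- int m, int m} else {- int m..int m})"
  define D :: "'n \<times> nat \<Rightarrow> ((int,'n) vec) set" where "D = (\<lambda>(i,m). {k. \<forall>j. k $ j \<in> F i m j})"
  have finF: "finite (F i m j)" for i m j
    by (simp add: F_def)
  have finD: "finite (D p)" for p
    unfolding D_def case_prod_beta by (intro finite_int_vec_product finF)
  \<comment> \<open>The division by \<open>N\<close>, the number of possible \<open>m\<close>, makes the bound uniform in \<open>m\<close> and lets the sum
    over \<open>m\<close> cancel it. It is here that \<open>n \<ge> 2\<close> enters: \<open>m ^ (n - 2) \<le> K ^ (n - 2)\<close>.\<close>
  have cardD: "real (card (D (i,m))) / m \<le> 2 * (3 * K) ^ (CARD('n) - 1) / N"
    if m: "m \<in> {1..N}" for i m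
  proof -
    obtain d where d: "CARD('n) = Suc (Suc d)"
      using le_Suc_ex[OF n] by auto
    have "real (card (D (i,m))) = (\<Prod>j\<in>UNIV. real (card (F i m j)))"
      unfolding D_def prod.case by (subst card_int_vec_product) (auto simp: finF)
    also have "\<dots> = real (card (F i m i)) * (\<Prod>j\<in>UNIV - {i}. real (card (F i m j)))"
      by (subst prod.remove[of UNIV i]) auto
    also have "\<dots> = 2 * real (2 * m + 1) ^ Suc d"
      using m by (simp add: F_def d card_insert_if nat_add_distrib nat_mult_distrib algebra_simps)
    also have "\<dots> \<le> 2 * (3 * real m) ^ Suc d"
      using m by (intro mult_left_mono power_mono) auto
    also have "\<dots> = 2 * 3 ^ Suc d * real m ^ d * m"
      by (simp only: power_mult_distrib power_Suc mult_ac)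
    finally have "real (card (D (i,m))) / m \<le> 2 * 3 ^ Suc d * real m ^ d"
      using m by (simp add: divide_le_eq)
    also have "\<dots> \<le> 2 * 3 ^ Suc d * (K ^ d * (K / N))"
    proof -
      have "real m ^ d \<le> K ^ d"
        using m N by (intro power_mono) auto
      moreover have "1 \<le> K / N"
        using N by simp
      ultimately have "real m ^ d * 1 \<le> K ^ d * (K / N)"
        using K by (intro mult_mono) auto
      then show ?thesis
        by (intro mult_left_mono) auto
    qed
    also have "\<dots> = 2 * (3 * K) ^ (CARD('n) - 1) / N"
      by (simp add: d power_mult_distrib)
    finally show ?thesis .
  qed
  have "(\<Sum>k\<in>(\<G>_upto K :: ((int,'n) vec) set). 1 / norm (vec_of_int k))
          \<le> (\<Sum>(p,k)\<in>Sigma (UNIV \<times> {1..N}) D. 1 / real (snd p))"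
  proof (rule sum_le_included[where i = snd])
    show "\<forall>k\<in>\<G>_upto K. \<exists>q\<in>Sigma (UNIV \<times> {1..N}) D.
        snd q = k \<and> 1 / norm (vec_of_int k) \<le> (case q of (p,k) \<Rightarrow> 1 / real (snd p))"
    proof
      fix k :: "(int,'n) vec"
      assume "k \<in> \<G>_upto K"
      then have le: "norm1 k \<le> \<lfloor>K\<rfloor>" and "k \<noteq> 0"
        by (auto simp: \<G>_upto_def \<G>_def le_floor_iff)
      obtain i where i: "\<And>j. \<bar>k $ j\<bar> \<le> \<bar>k $ i\<bar>"
      proof -
        have "Max (range (\<lambda>j. \<bar>k $ j\<bar>)) \<in> range (\<lambda>j. \<bar>k $ j\<bar>)"
          by (rule Max_in) auto
        then obtain i where i: "Max (range (\<lambda>j. \<bar>k $ j\<bar>)) = \<bar>k $ i\<bar>" by blast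
        show ?thesis
          by (intro that[of i]) (simp flip: i)
      qed
      define m where "m = nat \<bar>k $ i\<bar>"
      have "k $ i \<noteq> 0"
      proof
        assume "k $ i = 0"
        with i have "k = 0"
          by (simp add: vec_eq_iff)
        with \<open>k \<noteq> 0\<close> show False by simp
      qed
      then have m: "m \<in> {1..N}"
        using abs_component_le_norm1[of k i] le by (auto simp: m_def N_def)
      have "k \<in> D (i, m)"
        using i unfolding D_def F_def m_def by (auto simp: abs_le_iff minus_le_iff)
      moreover have "real m \<le> norm (vec_of_int k)"
        using component_le_norm_cart[of "vec_of_int k" i] by (simp add: m_def vec_of_int_def)
      then have "1 / norm (vec_of_int k) \<le> 1 / real m"
        using m by (intro divide_left_mono mult_pos_pos) auto
      ultimately show "\<exists>q\<in>Sigma (UNIV \<times> {1..N}) D.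
        snd q = k \<and> 1 / norm (vec_of_int k) \<le> (case q of (p,k) \<Rightarrow> 1 / real (snd p))"
        using m by (intro bexI[of _ "((i,m),k)"]) auto
    qed
  qed (auto simp: finite_\<G>_upto intro!: finite_SigmaI finD)
  also have "\<dots> = (\<Sum>p\<in>UNIV \<times> {1..N}. \<Sum>k\<in>D p. 1 / real (snd p))"
    by (subst sum.Sigma) (auto simp: finD)
  also have "\<dots> = (\<Sum>(i,m)\<in>UNIV \<times> {1..N}. real (card (D (i,m))) / m)"
    by (intro sum.cong) auto
  also have "\<dots> \<le> (\<Sum>(i,m)\<in>(UNIV :: 'n set) \<times> {1..N}. 2 * (3 * K) ^ (CARD('n) - 1) / N)"
    using cardD by (intro sum_mono) auto
  also have "\<dots> = 2 * real CARD('n) * (3 * K) ^ (CARD('n) - 1)"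
    using N by (simp add: card_cartesian_product case_prod_beta)
  finally show ?thesis .
qed

section \<open>Independent resonances\<close>

text \<open>
  If all minors of \<open>(k, l)\<close> vanish, then \<open>k $ i\<close> divides every \<open>l $ i * k $ j\<close>. As the components of
  \<open>k\<close> have greatest common divisor 1, it divides \<open>l $ i\<close>, and the quotient is the factor by which
  \<open>l\<close> is a multiple of \<open>k\<close>.\<close>

lemma \<G>_minor_nonzero:
  fixes k l :: "int ^ 'n::{finite,linorder}"
  assumes "k \<in> \<G>" "l \<notin> int_multiples k"
  obtains i j where "k $ i * l $ j \<noteq> k $ j * l $ i"
proof (rule ccontr)
  assume "\<not> thesis"
  with that have eq: "k $ i * l $ j = k $ j * l $ i" for i j
    by blast
  from assms obtain i where i: "k $ i \<noteq> 0" and gcd: "(GCD j. k $ j) = 1"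
    unfolding \<G>_def by force
  have "k $ i dvd (GCD j. l $ i * k $ j)"
    by (intro Gcd_greatest) (auto simp: mult.commute[of "l $ i"] simp flip: eq[of i])
  also have "(GCD j. l $ i * k $ j) = normalize (l $ i * (GCD j. k $ j))"
    using Gcd_mult[of "l $ i" "range (\<lambda>j. k $ j)"] by (simp add: image_image)
  finally have "k $ i dvd l $ i"
    by (simp add: gcd)
  then obtain m where m: "l $ i = k $ i * m" by blast
  have "l $ j = m * k $ j" for j
    using eq[of i j] i by (simp add: m algebra_simps)
  then have "l = m *s k"
    by (simp add: vec_eq_iff)
  with assms(2) show False
    unfolding int_multiples_def by blast
qed

lemma abs_det_ge_1:
  fixes A :: "real ^ 'n ^ 'n"
  assumes "\<And>i j. A $ i $ j \<in> \<int>" "det A \<noteq> 0"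
  shows "\<bar>det A\<bar> \<ge> 1"
proof -
  have "det A \<in> \<int>"
    unfolding det_def using assms(1) by (intro Ints_sum Ints_mult Ints_prod) auto
  with assms(2) show ?thesis
    by (metis Ints_nonzero_abs_ge1)
qed

section \<open>Volume of a slab in two directions\<close>

text \<open>
  The condition on \<open>v\<close> is sheared along \<open>u\<close> because \<open>v\<close> will be an integer vector, whereas its
  projection orthogonal to \<open>u\<close> need not be integral; the projection is \<open>v - c *\<^sub>R u\<close> for a suitable
  \<open>c\<close>. Integrality of \<open>u\<close> and \<open>v\<close> gives the bound on the volume, and the shear does not change the
  volume.\<close>

definition slab :: "'a::euclidean_space \<Rightarrow> 'a \<Rightarrow> real \<Rightarrow> real \<Rightarrow> real \<Rightarrow> 'a set"
  where "slab u v c a b = {y \<in> cball 0 1. \<bar>y \<bullet> u\<bar> \<le> a \<and> \<bar>y \<bullet> v - c * (y \<bullet> u)\<bar> \<le> b}"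

lemma compact_slab:
  fixes u v :: "'a::euclidean_space"
  shows "compact (slab u v c a b)"
proof -
  have "closed {y. \<bar>y \<bullet> u\<bar> \<le> a \<and> \<bar>y \<bullet> v - c * (y \<bullet> u)\<bar> \<le> b}"
    by (intro closed_Collect_conj closed_Collect_le continuous_intros)
  then have "compact (cball 0 1 \<inter> {y. \<bar>y \<bullet> u\<bar> \<le> a \<and> \<bar>y \<bullet> v - c * (y \<bullet> u)\<bar> \<le> b})"
    by (intro compact_Int_closed compact_cball)
  then show ?thesis
    by (simp add: slab_def Int_def conj_assoc)
qed

text \<open>
  The matrix \<open>A\<close> replaces the coordinates \<open>i\<close> and \<open>j\<close> by \<open>y \<bullet> u\<close> and \<open>y \<bullet> v\<close>. It is integral,
  and it is invertible since the minor is nonzero, so \<open>\<bar>det A\<bar> \<ge> 1\<close>. The row operation leading to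
  \<open>A'\<close> preserves the determinant, and \<open>A'\<close> maps the slab into a box with sides \<open>2 * a\<close>, \<open>2 * b\<close> and,
  \<open>n - 2\<close> times, 2. The change of variables formula \<open>measure_linear_image\<close> asks for
  a well-ordered index type.\<close>

lemma measure_slab_le_wellorder:
  fixes u v :: "real ^ 'n::{finite,wellorder}"
  assumes int: "\<And>m. u $ m \<in> \<int>" "\<And>m. v $ m \<in> \<int>"
    and minor: "u $ i * v $ j \<noteq> u $ j * v $ i"
    and ab: "a \<ge> 0" "b \<ge> 0"
  shows "measure lebesgue (slab u v c a b) \<le> 2 ^ CARD('n) * a * b"
  (is "measure _ ?S \<le> _")
proof -
  have ij: "i \<noteq> j"
    using minor by auto
  define A :: "((real,'n) vec,'n) vec" where "A = (\<chi> m. if m = i then u else if m = j then v else axis m 1)"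
  define A' :: "((real,'n) vec,'n) vec"
    where "A' = (\<chi> m. if m = j then row j A + (- c) *s row i A else row m A)"
  have rowA: "A $ i = u" "A $ j = v" "m \<noteq> i \<Longrightarrow> m \<noteq> j \<Longrightarrow> A $ m = axis m 1" for m
    using ij by (auto simp: A_def)
  have row_eq: "row m A = A $ m" for m
    by (simp add: row_def vec_eq_iff)
  have "det A \<noteq> 0"
  proof -
    have "y = 0" if "A *v y = 0" for y
    proof -
      have Ay: "A $ m \<bullet> y = 0" for m
        using that by (metis matrix_vector_mul_component zero_index)
      \<comment> \<open>Rows other than \<open>i\<close>, \<open>j\<close> leave a \<open>2 \<times> 2\<close> system in \<open>y $ i\<close>, \<open>y $ j\<close> whose determinant is the
        minor.\<close>
      have y0: "y $ m = 0" if "m \<noteq> i" "m \<noteq> j" for m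
        using Ay[of m] that by (simp add: rowA inner_axis')
      have ip: "w \<bullet> y = w $ i * y $ i + w $ j * y $ j" for w :: "(real,'n) vec"
      proof -
        have "w \<bullet> y = (\<Sum>m\<in>{i,j}. w $ m * y $ m)"
          unfolding inner_vec_def by (rule sum.mono_neutral_cong_right) (auto simp: y0)
        with ij show ?thesis by simp
      qed
      have e: "u $ i * y $ i + u $ j * y $ j = 0" "v $ i * y $ i + v $ j * y $ j = 0"
        using Ay[of i] Ay[of j] by (simp_all add: rowA ip)
      have "(u $ i * v $ j - u $ j * v $ i) * y $ i = 0" "(u $ i * v $ j - u $ j * v $ i) * y $ j = 0"
        using e by algebra+
      with minor have "y $ i = 0" "y $ j = 0"
        by auto
      with y0 show "y = 0"
        by (metis vec_eq_iff zero_index)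
    qed
    then have "invertible A"
      by (meson invertible_left_inverse matrix_left_invertible_ker)
    then show ?thesis
      by (simp add: invertible_det_nz)
  qed
  then have "\<bar>det A\<bar> \<ge> 1"
    by (intro abs_det_ge_1) (auto simp: A_def int axis_def)
  moreover have "det A' = det A"
    unfolding A'_def using ij by (intro det_row_operation) auto
  ultimately have det: "\<bar>det (matrix ((*v) A'))\<bar> \<ge> 1"
    by simp
  have S: "?S \<in> lmeasurable"
    by (intro lmeasurable_compact compact_slab)
  define w :: "(real,'n) vec" where "w = (\<chi> m. if m = i then a else if m = j then b else 1)"
  have "measure lebesgue ?S \<le> \<bar>det (matrix ((*v) A'))\<bar> * measure lebesgue ?S"
    using det by (simp add: mult_le_cancel_right1)
  also have "\<dots> = measure lebesgue ((*v) A' ` ?S)"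
    by (rule measure_linear_image[symmetric]) (use S in auto)
  also have "\<dots> \<le> measure lebesgue (cbox (- w) w)"
  proof (rule measure_mono_fmeasurable)
    have "(*v) A' ` ?S \<in> lmeasurable"
      by (rule measurable_linear_image) (use S in auto)
    then show "(*v) A' ` ?S \<in> sets lebesgue"
      by auto
    show "(*v) A' ` ?S \<subseteq> cbox (- w) w"
    proof (rule image_subsetI)
      fix y assume "y \<in> ?S"
      then have y_slab: "norm y \<le> 1" "\<bar>y \<bullet> u\<bar> \<le> a" "\<bar>y \<bullet> v - c * (y \<bullet> u)\<bar> \<le> b"
        by (auto simp: slab_def)
      have "\<bar>(A' *v y) $ m\<bar> \<le> w $ m" for m
      proof -
        consider "m = i" | "m = j" | "m \<noteq> i" "m \<noteq> j" by blast
        then show ?thesis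
        proof cases
          case 1
          with y_slab ij show ?thesis
            by (simp add: matrix_vector_mul_component A'_def row_eq rowA w_def inner_commute)
        next
          case 2
          then have "(A' *v y) $ m = y \<bullet> v - c * (y \<bullet> u)"
            using ij by (simp add: matrix_vector_mul_component A'_def row_eq rowA inner_commute
                inner_diff_right scalar_mult_eq_scaleR)
          with 2 y_slab ij show ?thesis
            by (simp add: w_def)
        next
          case 3
          have "\<bar>y $ m\<bar> \<le> 1"
            using y_slab component_le_norm_cart[of y m] by auto
          with 3 show ?thesis
            by (simp add: matrix_vector_mul_component A'_def row_eq rowA w_def inner_axis')
        qed
      qed
      then show "A' *v y \<in> cbox (- w) w"
        by (auto simp: mem_box_cart abs_le_iff minus_le_iff)
    qed
  qed auto
  also have "measure lebesgue (cbox (- w) w) = (\<Prod>m\<in>UNIV. 2 * w $ m)"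
    using ab by (simp, subst content_cbox_cart) (auto simp: interval_eq_empty_cart w_def not_less)
  also have "\<dots> = 2 ^ CARD('n) * (\<Prod>m\<in>UNIV. w $ m)"
    by (simp add: prod.distrib)
  also have "(\<Prod>m\<in>UNIV. w $ m) = (\<Prod>m\<in>{i,j}. w $ m)"
    by (rule prod.mono_neutral_right) (auto simp: w_def)
  also have "\<dots> = a * b"
    using ij by (simp add: w_def)
  finally show ?thesis
    by (simp add: mult.assoc)
qed

section \<open>Reindexing by a well-ordered type\<close>

text \<open>
  A copy of a finite index type, carrying a well-order instead of whatever order the type itself may
  have. It serves to carry the volume bound over to an arbitrary finite index type.\<close>

typedef 'a wo_index = "UNIV :: 'a set"
  morphisms of_index to_index by simp

instance wo_index :: (finite) finite
proof
  have "inj (of_index :: 'a wo_index \<Rightarrow> 'a)"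
    by (simp add: inj_def of_index_inject)
  then show "finite (UNIV :: 'a wo_index set)"
    by (rule finite_imageD[rotated]) simp
qed

lemma bij_of_index: "bij of_index"
  by (rule bij_betw_byWitness[where f' = to_index])
     (auto simp: of_index_inverse to_index_inverse)

instantiation wo_index :: (finite) wellorder
begin

definition index_rank :: "'a wo_index \<Rightarrow> nat"
  where "index_rank = (SOME f. inj f)"

definition less_eq_wo_index :: "'a wo_index \<Rightarrow> 'a wo_index \<Rightarrow> bool"
  where "less_eq_wo_index x y \<longleftrightarrow> index_rank x \<le> index_rank y"

definition less_wo_index :: "'a wo_index \<Rightarrow> 'a wo_index \<Rightarrow> bool"
  where "less_wo_index x y \<longleftrightarrow> index_rank x < index_rank y"

lemma inj_index_rank: "inj (index_rank :: 'a wo_index \<Rightarrow> nat)"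
  unfolding index_rank_def
  by (rule someI_ex[of inj])
     (use finite_imp_inj_to_nat_seg[of "UNIV :: 'a wo_index set"] in auto)

instance
proof
  fix x y z :: "'a wo_index"
  show "x < y \<longleftrightarrow> x \<le> y \<and> \<not> y \<le> x" "x \<le> x" "x \<le> y \<or> y \<le> x"
    unfolding less_eq_wo_index_def less_wo_index_def by linarith+
  show "x \<le> z" if "x \<le> y" "y \<le> z"
    using that unfolding less_eq_wo_index_def by linarith
  show "x = y" if "x \<le> y" "y \<le> x"
    using that inj_index_rank unfolding less_eq_wo_index_def by (meson injD le_antisym)
next
  fix P :: "'a wo_index \<Rightarrow> bool" and x
  assume "\<And>x. (\<And>y. y < x \<Longrightarrow> P y) \<Longrightarrow> P x"
  then show "P x"
    unfolding less_wo_index_def by (rule measure_induct_rule[of index_rank])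
qed

end

definition reindex :: "real ^ 'n \<Rightarrow> real ^ ('n::finite wo_index)"
  where "reindex x = (\<chi> i. x $ of_index i)"

lemma inner_reindex: "reindex x \<bullet> reindex y = x \<bullet> y"
  unfolding inner_vec_def reindex_def vec_lambda_beta
  by (rule sum.reindex_bij_betw[OF bij_of_index])

lemma norm_reindex: "norm (reindex x) = norm x"
  by (simp add: norm_eq_sqrt_inner inner_reindex)

lemma CARD_wo_index: "CARD('a wo_index) = CARD('a)"
  using bij_betw_same_card[OF bij_of_index] .

lemma prod_Basis_cart:
  fixes x :: "real ^ 'n"
  shows "(\<Prod>b\<in>Basis. x \<bullet> b) = (\<Prod>i\<in>UNIV. x $ i)"
proof -
  have Basis: "(Basis :: (real ^ 'n) set) = range (\<lambda>i. axis i 1)"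
    by (auto simp: Basis_vec_def)
  have inj: "inj (\<lambda>i :: 'n. axis i (1 :: real))"
    by (auto simp: inj_on_def axis_eq_axis)
  show ?thesis
    unfolding Basis prod.reindex[OF inj] by (simp add: inner_axis)
qed

lemma borel_measurable_reindex [measurable]: "reindex \<in> borel_measurable borel"
  unfolding reindex_def by (intro borel_measurable_continuous_onI continuous_intros)

text \<open>
  Renaming the coordinates maps boxes to boxes with the same sides, which determines Lebesgue measure.\<close>

lemma lborel_reindex: "lborel = distr lborel borel reindex"
proof (rule lborel_eqI)
  fix l u :: "real ^ ('n::finite wo_index)"
  assume lu: "\<And>b :: (real, 'n wo_index) vec. b \<in> Basis \<Longrightarrow> l \<bullet> b \<le> u \<bullet> b"
  then have le: "l $ i \<le> u $ i" for i
    by (simp add: cart_eq_inner_axis axis_in_Basis_iff)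
  define pull :: "(real, 'n wo_index) vec \<Rightarrow> (real, 'n) vec"
    where "pull x = (\<chi> i. x $ to_index i)" for x
  have all_index: "(\<forall>i. P i) \<longleftrightarrow> (\<forall>i. P (to_index i))" for P :: "'n wo_index \<Rightarrow> bool"
    by (metis of_index_inverse)
  have "reindex -` box l u = box (pull l) (pull u)"
    unfolding reindex_def pull_def
    by (simp add: mem_box_cart set_eq_iff all_index to_index_inverse)
  then have "emeasure (distr lborel borel reindex) (box l u) = emeasure lborel (box (pull l) (pull u))"
    by (simp add: emeasure_distr)
  also have "\<dots> = (\<Prod>b\<in>Basis. (pull u - pull l) \<bullet> b)"
    by (rule emeasure_lborel_box) (auto simp: Basis_vec_def inner_axis pull_def le)
  also have "\<dots> = (\<Prod>i\<in>UNIV. (pull u - pull l) $ i)"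
    by (simp only: prod_Basis_cart)
  also have "(\<Prod>i\<in>UNIV. (pull u - pull l) $ i) = (\<Prod>i\<in>UNIV. (pull u - pull l) $ of_index i)"
    by (rule prod.reindex_bij_betw[OF bij_of_index, symmetric])
  also have "\<dots> = (\<Prod>b\<in>Basis. (u - l) \<bullet> b)"
    by (simp only: prod_Basis_cart) (simp add: pull_def of_index_inverse)
  finally show "emeasure (distr lborel borel reindex) (box l u) = (\<Prod>b\<in>Basis. (u - l) \<bullet> b)" .
qed simp

lemma measure_reindex_vimage:
  assumes "S \<in> sets borel"
  shows "measure lebesgue (reindex -` S) = measure lebesgue S"
proof -
  have "reindex -` S \<in> sets borel"
    using measurable_sets[OF borel_measurable_reindex assms] by simp
  then have "measure lebesgue (reindex -` S) = measure lborel (reindex -` S)"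
    by (simp add: measure_completion)
  also have "\<dots> = measure (distr lborel borel reindex) S"
    using assms by (simp add: measure_distr)
  also have "\<dots> = measure lebesgue S"
    using assms by (simp add: measure_completion flip: lborel_reindex)
  finally show ?thesis .
qed

lemma measure_slab_le:
  fixes u v :: "real ^ 'n::finite"
  assumes int: "\<And>m. u $ m \<in> \<int>" "\<And>m. v $ m \<in> \<int>"
    and minor: "u $ i * v $ j \<noteq> u $ j * v $ i"
    and ab: "a \<ge> 0" "b \<ge> 0"
  shows "measure lebesgue (slab u v c a b) \<le> 2 ^ CARD('n) * a * b"
  (is "measure _ ?S \<le> _")
proof -
  let ?T = "slab (reindex u) (reindex v) c a b"
  have "?S = reindex -` ?T"
    by (auto simp: slab_def inner_reindex norm_reindex)
  then have "measure lebesgue ?S = measure lebesgue ?T"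
    using measure_reindex_vimage[OF borel_compact[OF compact_slab]] by simp
  also have "\<dots> \<le> 2 ^ CARD('n wo_index) * a * b"
    by (rule measure_slab_le_wellorder[where i = "to_index i" and j = "to_index j"])
       (use assms in \<open>auto simp: reindex_def to_index_inverse\<close>)
  finally show ?thesis
    by (simp add: CARD_wo_index)
qed

section \<open>Covering by double resonances\<close>

text \<open>
  The shear coefficient turns \<open>y \<bullet> l\<close> into \<open>proj_perp k y \<bullet> l\<close>: these are the points of the closed unit ball where
  \<open>\<bar>y \<bullet> k\<bar> \<le> \<alpha>\<close> and the second inequality in the definition of \<open>R1k\<close> fails at \<open>l\<close>. The closed
  conditions make the set compact.\<close>

definition double_resonance ::
    "real \<Rightarrow> real \<Rightarrow> int ^ 'n \<Rightarrow> int ^ 'n \<Rightarrow> (real ^ 'n::finite) set"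
  where "double_resonance \<alpha> K k l =
    slab (vec_of_int k) (vec_of_int l)
      ((vec_of_int k \<bullet> vec_of_int l) / (norm (vec_of_int k))\<^sup>2)
      \<alpha> (3 * \<alpha> * K / norm (vec_of_int k))"

lemma R2_subset_double_resonances:
  fixes \<alpha> Ko K :: real
  assumes "\<alpha> > 0" "Ko \<ge> 1"
  shows "(R2 \<alpha> Ko K :: (real ^ 'n::{finite,linorder}) set)
    \<subseteq> (\<Union>k\<in>\<G>_upto Ko. \<Union>l\<in>\<G>_upto K - int_multiples k. double_resonance \<alpha> K k l)"
proof
  fix y :: "(real, 'n) vec"
  assume y: "y \<in> R2 \<alpha> Ko K"
  then have B: "y \<in> B" and "y \<notin> R0 \<alpha> Ko" and R1: "y \<notin> R1 \<alpha> Ko K"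
    unfolding R2_def by auto
  then have "\<not> \<alpha> / 2 < Min ((\<lambda>k. \<bar>y \<bullet> vec_of_int k\<bar>) ` \<G>_upto Ko)"
    unfolding R0_def by simp
  then obtain k where k: "k \<in> \<G>_upto Ko" "\<bar>y \<bullet> vec_of_int k\<bar> \<le> \<alpha> / 2"
    using \<G>_upto_nonempty[OF assms(2)]
    by (subst (asm) Min_gr_iff) (auto simp: finite_\<G>_upto not_less)
  with R1 B \<open>\<alpha> > 0\<close> obtain l where l: "l \<in> \<G>_upto K - int_multiples k"
    "\<bar>proj_perp k y \<bullet> vec_of_int l\<bar> \<le> 3 * \<alpha> * K / norm (vec_of_int k)"
    unfolding R1_def R1k_def by (force simp: not_less)
  have "proj_perp k y \<bullet> vec_of_int l =
      y \<bullet> vec_of_int l - (vec_of_int k \<bullet> vec_of_int l) / (norm (vec_of_int k))\<^sup>2 * (y \<bullet> vec_of_int k)"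
    by (simp add: proj_perp_def proj_def inner_diff_left)
  with k l B \<open>\<alpha> > 0\<close> show "y \<in> (\<Union>k\<in>\<G>_upto Ko. \<Union>l\<in>\<G>_upto K - int_multiples k. double_resonance \<alpha> K k l)"
    by (intro UN_I[of k] UN_I[of l]) (auto simp: B_def double_resonance_def slab_def)
qed

text \<open>
  The factor \<open>1 / \<bar>k\<bar>\<close> comes from the width allowed for \<open>proj_perp k y \<bullet> l\<close>; it is what makes
  the sum over \<open>k\<close> gain a power.\<close>

lemma measure_double_resonance_le:
  fixes k l :: "int ^ 'n::{finite,linorder}"
  assumes k: "k \<in> \<G>" and l: "l \<notin> int_multiples k" and "\<alpha> \<ge> 0" "K \<ge> 0"
  shows "measure lebesgue (double_resonance \<alpha> K k l)
           \<le> 2 ^ CARD('n) * (3 * \<alpha>\<^sup>2 * K) * (1 / norm (vec_of_int k))"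
proof -
  obtain i j where "k $ i * l $ j \<noteq> k $ j * l $ i"
    using \<G>_minor_nonzero[OF k l] .
  then have "vec_of_int k $ i * vec_of_int l $ j \<noteq> vec_of_int k $ j * vec_of_int l $ i"
    by (simp add: vec_of_int_def flip: of_int_mult)
  then have "measure lebesgue (double_resonance \<alpha> K k l)
      \<le> 2 ^ CARD('n) * \<alpha> * (3 * \<alpha> * K / norm (vec_of_int k))"
    unfolding double_resonance_def
    by (rule measure_slab_le[rotated 2]) (use assms in \<open>auto simp: vec_of_int_def\<close>)
  then show ?thesis
    by (simp add: power2_eq_square mult_ac)
qed

lemma measure_R2_le:
  fixes \<alpha> Ko K :: real
  assumes n: "CARD('n::{finite,linorder}) \<ge> 2"
    and "\<alpha> > 0" "1 \<le> Ko" "Ko \<le> K"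
  shows "measure lebesgue (R2 \<alpha> Ko K :: (real ^ 'n::{finite,linorder}) set)
           \<le> 2 * real CARD('n) * 18 ^ CARD('n) * \<alpha>\<^sup>2 * K ^ (2 * CARD('n))"
proof -
  define n where "n = CARD('n)"
  let ?L = "\<lambda>k. \<G>_upto K - int_multiples k :: (int,'n) vec set"
  let ?U = "\<lambda>k. \<Union>l\<in>?L k. double_resonance \<alpha> K k l"
  have finL: "finite (?L k)" for k
    by (simp add: finite_\<G>_upto)
  have lm: "double_resonance \<alpha> K k l \<in> lmeasurable" for k l :: "(int,'n) vec"
    unfolding double_resonance_def
    by (intro lmeasurable_compact compact_slab)
  have "measure lebesgue (R2 \<alpha> Ko K :: (real,'n) vec set)
      \<le> measure lebesgue (\<Union>k\<in>\<G>_upto Ko. ?U k)"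
  proof (rule measure_mono_fmeasurable)
    show "R2 \<alpha> Ko K \<subseteq> (\<Union>k\<in>\<G>_upto Ko. ?U k)"
      using assms by (intro R2_subset_double_resonances) auto
    show "(R2 \<alpha> Ko K :: (real,'n) vec set) \<in> sets lebesgue"
      using R2_lmeasurable[of Ko \<alpha> K] assms by auto
    show "(\<Union>k\<in>\<G>_upto Ko. ?U k) \<in> lmeasurable"
      by (intro fmeasurable.finite_UN finite_\<G>_upto finL lm)
  qed
  also have "\<dots> \<le> (\<Sum>k\<in>\<G>_upto Ko. measure lebesgue (?U k))"
    by (rule measure_UNION_le)
       (auto simp: finite_\<G>_upto intro!: fmeasurableD lm)
  also have "\<dots> \<le> (\<Sum>k\<in>\<G>_upto Ko. \<Sum>l\<in>?L k. measure lebesgue (double_resonance \<alpha> K k l))"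
    by (intro sum_mono measure_UNION_le finL fmeasurableD lm)
  also have "\<dots> \<le> (\<Sum>k\<in>(\<G>_upto Ko :: (int,'n) vec set).
      (3 * K) ^ n * (2 ^ n * (3 * \<alpha>\<^sup>2 * K)) * (1 / norm (vec_of_int k)))"
  proof (rule sum_mono)
    fix k :: "(int,'n) vec"
    assume k: "k \<in> \<G>_upto Ko"
    have "(\<Sum>l\<in>?L k. measure lebesgue (double_resonance \<alpha> K k l))
        \<le> real (card (?L k)) * (2 ^ n * (3 * \<alpha>\<^sup>2 * K) * (1 / norm (vec_of_int k)))"
      by (rule sum_bounded_above) (use measure_double_resonance_le[of k _ \<alpha> K] k assms in \<open>auto simp: n_def \<G>_upto_def\<close>)
    also have "\<dots> \<le> (3 * K) ^ n * (2 ^ n * (3 * \<alpha>\<^sup>2 * K) * (1 / norm (vec_of_int k)))"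
    proof (rule mult_right_mono)
      have "real (card (?L k)) \<le> real (card (\<G>_upto K :: (int,'n) vec set))"
        by (intro of_nat_mono card_mono finite_\<G>_upto) auto
      also have "\<dots> \<le> (3 * K) ^ n"
        unfolding n_def using assms by (intro card_\<G>_upto_le) auto
      finally show "real (card (?L k)) \<le> (3 * K) ^ n" .
    qed (use assms in auto)
    finally show "(\<Sum>l\<in>?L k. measure lebesgue (double_resonance \<alpha> K k l))
        \<le> (3 * K) ^ n * (2 ^ n * (3 * \<alpha>\<^sup>2 * K)) * (1 / norm (vec_of_int k))"
      by (simp add: mult.assoc)
  qed
  also have "\<dots> = (3 * K) ^ n * (2 ^ n * (3 * \<alpha>\<^sup>2 * K)) *
      (\<Sum>k\<in>(\<G>_upto Ko :: (int,'n) vec set). 1 / norm (vec_of_int k))"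
    by (simp only: sum_distrib_left)
  also have "\<dots> \<le> (3 * K) ^ n * (2 ^ n * (3 * \<alpha>\<^sup>2 * K)) * (2 * real n * (3 * K) ^ (n - 1))"
  proof (rule mult_left_mono)
    have "(\<Sum>k\<in>(\<G>_upto Ko :: (int,'n) vec set). 1 / norm (vec_of_int k))
        \<le> 2 * real n * (3 * Ko) ^ (n - 1)"
      unfolding n_def using assms by (intro sum_inverse_norm_\<G>_upto_le) auto
    also have "\<dots> \<le> 2 * real n * (3 * K) ^ (n - 1)"
      using assms by (intro mult_left_mono power_mono) auto
    finally show "(\<Sum>k\<in>(\<G>_upto Ko :: (int,'n) vec set). 1 / norm (vec_of_int k))
        \<le> 2 * real n * (3 * K) ^ (n - 1)" .
  qed (use assms in auto)
  also have "\<dots> = 2 * real n * 18 ^ n * \<alpha>\<^sup>2 * K ^ (2 * n)"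
  proof -
    obtain d where d: "n = Suc d"
      using assms(1) by (cases n) (auto simp: n_def)
    have "(3 * K) ^ n * (2 ^ n * (3 * \<alpha>\<^sup>2 * K)) * (2 * real n * (3 * K) ^ (n - 1))
        = 2 * real n * (2 ^ n * 3 ^ n * (3 * 3 ^ (n - 1))) * \<alpha>\<^sup>2 * (K ^ n * (K * K ^ (n - 1)))"
      by (simp only: power_mult_distrib mult_ac)
    also have "3 * 3 ^ (n - 1) = (3 :: real) ^ n"
      by (simp add: d)
    also have "K ^ n * (K * K ^ (n - 1)) = K ^ (2 * n)"
      by (simp add: d mult_2 power_add)
    also have "2 ^ n * 3 ^ n * 3 ^ n = (18 :: real) ^ n"
      by (simp flip: power_mult_distrib)
    finally show ?thesis .
  qed
  finally show ?thesis
    by (simp add: n_def)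
qed

theorem lemma2p5:
  assumes "CARD('n::{finite,linorder}) \<ge> 2"
  shows "\<exists>c > 1. \<forall>(\<epsilon>::real) (K::real) (Ko::real) (\<alpha>::real).
    0 < \<epsilon> \<longrightarrow> \<epsilon> < 1 \<longrightarrow> K \<ge> 6 * Ko \<longrightarrow> 6 * Ko \<ge> 12 \<longrightarrow>
    \<alpha> = sqrt \<epsilon> * K powr (9 / 2 * real CARD('n::{finite,linorder}) + 2) \<longrightarrow>
    measure lebesgue (R2 \<alpha> Ko K :: (real ^ 'n::{finite,linorder}) set) \<le> c * \<alpha>\<^sup>2 * K ^ (2 * CARD('n))"
proof (intro exI[of _ "2 * real CARD('n) * 18 ^ CARD('n)"] conjI allI impI)
  have "1 * 1 < 2 * real CARD('n) * 18 ^ CARD('n)"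
    using assms by (intro mult_less_le_imp_less) auto
  then show "1 < 2 * real CARD('n) * 18 ^ CARD('n)"
    by simp
next
  fix \<epsilon> K Ko \<alpha> :: real
  assume "0 < \<epsilon>" "\<epsilon> < 1" "K \<ge> 6 * Ko" "6 * Ko \<ge> 12"
    and \<alpha>: "\<alpha> = sqrt \<epsilon> * K powr (9 / 2 * real CARD('n) + 2)"
  then have "\<alpha> > 0" "1 \<le> Ko" "Ko \<le> K"
    by auto
  from measure_R2_le[OF assms this]
  show "measure lebesgue (R2 \<alpha> Ko K :: (real,'n) vec set)
      \<le> 2 * real CARD('n) * 18 ^ CARD('n) * \<alpha>\<^sup>2 * K ^ (2 * CARD('n))"
    by simp
qed

end
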